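(* Let $n\ge 1$ and let $u,v$ be vertices of the Fibonacci cube $\Gamma_n$ with $d(u,v)=n$. Then the number of shortest paths from $u$ to $v$ in $\Gamma_n$ equals $E_n$, the $n$th Euler number.
   Context: For $n\ge1$, the hypercube $Q_n$ has vertex set $B_n=\{b_1\cdots b_n: b_i\in\{0,1\}\}$, two strings adjacent iff they differ in exactly one coordinate. The Fibonacci cube $\Gamma_n$ is the subgraph of $Q_n$ induced by the binary strings $b_1\cdots b_n$ with $b_ib_{i+1}=0$ for all $i\in\{1,\dots,n-1\}$. $d(u,v)$ is the graph distance in $\Gamma_n$ (the diameter of $\Gamma_n$ is $n$). A permutation $\sigma_1\cdots\sigma_n$ of $\{1,\dots,n\}$ is alternating if $\sigma_1>\sigma_2<\sigma_3>\sigma_4<\cdots$; the Euler number $E_n$ is the number of alternating permutations of $\{1,\dots,n\}$ (with $E_0=1$), so $E_1=1,E_2=1,E_3=2,E_4=5,E_5=16,E_6=61$; equivalently $\sum_{n\ge0}E_nx^n/n!=\sec x+\tan x$. *)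

theory Defs
  imports "Graph_Theory.Graph_Theory" "HOL-Combinatorics.Permutations"
begin

text \<open>
  Binary strings are Boolean lists (\<open>True\<close> for 1, \<open>False\<close> for 0), so that the letter
  \<open>b\<^sub>i\<close> of the string \<open>b\<^sub>1 \<dots> b\<^sub>n\<close> is \<open>b ! (i - 1)\<close>. As everywhere in this graph library, an
  undirected graph is a symmetric digraph.
\<close>

definition hypercube :: "nat \<Rightarrow> (bool list, bool list \<times> bool list) pre_digraph" where
  "hypercube n = with_proj \<lparr>
     pverts = {b. length b = n},
     parcs = {(b, c). length b = n \<and> length c = n \<and> card {i. i < n \<and> b ! i \<noteq> c ! i} = 1}\<rparr>"

definition fibonacci_strings :: "nat \<Rightarrow> bool list set" where
  "fibonacci_strings n = {b. length b = n \<and> (\<forall>i. Suc i < n \<longrightarrow> \<not> (b ! i \<and> b ! Suc i))}"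

definition fibonacci_cube :: "nat \<Rightarrow> (bool list, bool list \<times> bool list) pre_digraph" where
  "fibonacci_cube n = hypercube n \<restriction> fibonacci_strings n"

text \<open>Infinite if \<open>v\<close> is not reachable from \<open>u\<close>.\<close>

definition graph_dist :: "('a, 'b) pre_digraph \<Rightarrow> 'a \<Rightarrow> 'a \<Rightarrow> ereal" where
  "graph_dist G u v = wf_digraph.\<mu> G (\<lambda>_. 1) u v"

text \<open>
  Paths are lists of arcs; in a graph without parallel arcs and for a fixed start vertex
  these correspond one-to-one to vertex sequences.
\<close>

definition shortest_paths :: "('a, 'b) pre_digraph \<Rightarrow> 'a \<Rightarrow> 'a \<Rightarrow> 'b awalk set" where
  "shortest_paths G u v =
     {p. pre_digraph.apath G u p v \<and> ereal (real (length p)) = graph_dist G u v}"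

definition alternating :: "nat \<Rightarrow> (nat \<Rightarrow> nat) \<Rightarrow> bool" where
  "alternating n \<sigma> \<longleftrightarrow>
     (\<forall>i\<in>{1..<n}. if odd i then \<sigma> i > \<sigma> (i + 1) else \<sigma> i < \<sigma> (i + 1))"

definition euler_number :: "nat \<Rightarrow> nat" where
  "euler_number n = card {\<sigma>. \<sigma> permutes {1..n} \<and> alternating n \<sigma>}"

lemma graph_hypercube: "graph (hypercube n)"
proof -
  let ?V = "{b :: bool list. length b = n}"
  define A where "A = {(b :: bool list, c :: bool list). length b = n \<and> length c = n \<and>
    card {i. i < n \<and> b ! i \<noteq> c ! i} = 1}"
  have Q: "hypercube n = with_proj \<lparr>pverts = ?V, parcs = A\<rparr>"
    by (simp only: hypercube_def A_def)
  have finV: "finite ?V"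
    using finite_lists_length_eq[of "UNIV :: bool set" n] by simp
  have sub: "A \<subseteq> ?V \<times> ?V"
    unfolding A_def by blast
  have finA: "finite A"
    using sub finV by (meson finite_SigmaI finite_subset)
  have symA: "sym A"
  proof (rule symI)
    fix b c :: "bool list"
    assume bc: "(b, c) \<in> A"
    then have "card {i. i < n \<and> b ! i \<noteq> c ! i} = 1"
      unfolding A_def by blast
    also have "{i. i < n \<and> b ! i \<noteq> c ! i} = {i. i < n \<and> c ! i \<noteq> b ! i}"
      by blast
    finally show "(c, b) \<in> A"
      using bc unfolding A_def by blast
  qed
  have irreflA: "fst e \<noteq> snd e" if "e \<in> A" for e
  proof
    assume "fst e = snd e"
    then obtain b where "e = (b, b)"
      by (metis prod.collapse)
    then have "card {i. i < n \<and> b ! i \<noteq> b ! i} = 1"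
      using that unfolding A_def by blast
    then show False
      by simp
  qed
  interpret pair_graph "\<lparr>pverts = ?V, parcs = A\<rparr>"
  proof
    fix e assume "e \<in> parcs \<lparr>pverts = ?V, parcs = A\<rparr>"
    then have e: "e \<in> A" by simp
    show "fst e \<in> pverts \<lparr>pverts = ?V, parcs = A\<rparr>"
      and "snd e \<in> pverts \<lparr>pverts = ?V, parcs = A\<rparr>"
      using e sub by auto
    show "fst e \<noteq> snd e"
      using e by (rule irreflA)
  qed (simp_all add: finV finA symA symmetric_def)
  show ?thesis
    unfolding Q by (rule graph_axioms)
qed

lemma graph_fibonacci_cube: "graph (fibonacci_cube n)"
proof -
  interpret graph "hypercube n" by (rule graph_hypercube)
  have sub: "fibonacci_strings n \<subseteq> verts (hypercube n)"
    by (auto simp: fibonacci_strings_def hypercube_def)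
  interpret H: digraph "fibonacci_cube n"
    unfolding fibonacci_cube_def by (rule digraphI_induced) (rule induced_induce[OF sub])
  have "symmetric (fibonacci_cube n)"
    unfolding symmetric_conv
  proof
    fix e assume e: "e \<in> arcs (fibonacci_cube n)"
    then obtain e' where "e' \<in> arcs (hypercube n)"
      "tail (hypercube n) e = head (hypercube n) e'" "head (hypercube n) e = tail (hypercube n) e'"
      using sym_arcs unfolding symmetric_conv by (auto simp: fibonacci_cube_def)
    with e show "\<exists>e'\<in>arcs (fibonacci_cube n).
        tail (fibonacci_cube n) e = head (fibonacci_cube n) e' \<and>
        head (fibonacci_cube n) e = tail (fibonacci_cube n) e'"
      by (intro bexI[of _ e']) (simp_all add: fibonacci_cube_def)
  qed
  then show ?thesis by (rule H.graphI)
qed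

end

theory Submission
  imports Defs
begin

text \<open>
  Switching off the superfluous ones of \<open>u\<close> before switching on the missing ones shows that the
  distance in the Fibonacci cube is at most the Hamming distance. So vertices at distance \<open>n\<close> are
  complementary, and since neither has two adjacent ones, the letters of \<open>u\<close> alternate. A walk of
  length \<open>n\<close> flips each letter exactly once; it is given by the permutation that maps a
  position to the time at which it is flipped. It stays in the Fibonacci cube iff of any two adjacent
  positions the one holding the one is flipped first, which says that the permutation is alternating
  (possibly after reversing the order of the values).
\<close>

section \<open>Walks as indexed sequences of vertices\<close>

text \<open>Builds a walk from a sequence of states. The vertex list is computed along with it
  because \<open>apath\<close> asks for distinct vertices.\<close>

lemma (in wf_digraph) awalk_map_upt:
  assumes "s 0 \<in> verts G"
    and "\<And>k. k < m \<Longrightarrow> e k \<in> arcs G \<and> tail G (e k) = s k \<and> head G (e k) = s (Suc k)"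
  shows "awalk (s 0) (map e [0..<m]) (s m) \<and> awalk_verts (s 0) (map e [0..<m]) = map s [0..<Suc m]"
  using assms(2)
proof (induction m)
  case 0
  then show ?case using assms(1) by (simp add: awalk_Nil_iff)
next
  case (Suc m)
  then have IH: "awalk (s 0) (map e [0..<m]) (s m)"
    "awalk_verts (s 0) (map e [0..<m]) = map s [0..<Suc m]"
    and e: "e m \<in> arcs G" "tail G (e m) = s m" "head G (e m) = s (Suc m)" by auto
  have "awalk (s m) [e m] (s (Suc m))"
    using e head_in_verts[OF e(1)] by (simp add: awalk_simps)
  with IH(1) have walk: "awalk (s 0) (map e [0..<m] @ [e m]) (s (Suc m))"
    by (rule awalk_appendI)
  have "awalk_verts (s 0) (map e [0..<m] @ [e m]) = map s [0..<Suc (Suc m)]"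
    using awalk_verts_append[OF walk] IH(2) e by simp
  with walk show ?case by simp
qed

text \<open>The converse direction: it turns a walk into a time-indexed sequence of vertices, on
  which induction over the time is possible.\<close>

lemma (in wf_digraph) awalk_imp_steps:
  assumes "awalk u p v"
  obtains w where "w 0 = u" "w (length p) = v"
    "\<And>k. k < length p \<Longrightarrow> p ! k \<in> arcs G \<and> tail G (p ! k) = w k \<and> head G (p ! k) = w (Suc k)"
  using assms
proof (induction p arbitrary: u thesis)
  case Nil
  then show ?case by (auto simp: awalk_Nil_iff)
next
  case (Cons e p)
  then have e: "e \<in> arcs G" "u = tail G e" and "awalk (head G e) p v"
    by (auto simp: awalk_Cons_iff)
  with Cons.IH obtain w where w: "w 0 = head G e" "w (length p) = v"
    "\<And>k. k < length p \<Longrightarrow> p ! k \<in> arcs G \<and> tail G (p ! k) = w k \<and> head G (p ! k) = w (Suc k)"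
    by metis
  \<comment> \<open>\<open>case_nat u w\<close> puts \<open>u\<close> in front of the sequence and
    shifts \<open>w\<close> by one index.\<close>
  show ?case
    by (rule Cons.prems(1)[of "case_nat u w"]) (use e w in \<open>auto simp: nth_Cons split: nat.split\<close>)
qed

section \<open>Distance and antipodal vertices in the Fibonacci cube\<close>

lemma verts_fibonacci_cube [simp]: "verts (fibonacci_cube n) = fibonacci_strings n"
  by (simp add: fibonacci_cube_def)

lemma tail_fibonacci_cube [simp]: "tail (fibonacci_cube n) = fst"
  and head_fibonacci_cube [simp]: "head (fibonacci_cube n) = snd"
  by (simp_all add: fibonacci_cube_def hypercube_def)

lemma arcs_fibonacci_cube:
  "(b, c) \<in> arcs (fibonacci_cube n) \<longleftrightarrow>
     b \<in> fibonacci_strings n \<and> c \<in> fibonacci_strings n \<and> (\<exists>j. {i. i < n \<and> b ! i \<noteq> c ! i} = {j})"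
  by (auto simp: fibonacci_cube_def hypercube_def fibonacci_strings_def card_1_singleton_iff)

lemma wf_digraph_fibonacci_cube: "wf_digraph (fibonacci_cube n)"
proof -
  interpret graph "fibonacci_cube n" by (rule graph_fibonacci_cube)
  show ?thesis by (rule wf_digraph_axioms)
qed

lemma graph_dist_le_length:
  assumes "wf_digraph G" "pre_digraph.awalk G u p v"
  shows "graph_dist G u v \<le> ereal (real (length p))"
proof -
  interpret wf_digraph G by fact
  have "awalk_cost (\<lambda>_. 1) p = real (length p)"
    by (induction p) auto
  with min_cost_le_walk_cost[OF assms(2), of "\<lambda>_. 1"] show ?thesis
    by (simp add: graph_dist_def)
qed

text \<open>Induction on the Hamming distance: as long as the strings differ, some letter of
  \<open>u\<close> can be corrected to that of \<open>v\<close> without leaving the cube.\<close>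

lemma fibonacci_cube_Hamming_walk:
  assumes "u \<in> fibonacci_strings n" "v \<in> fibonacci_strings n"
  shows "\<exists>p. pre_digraph.awalk (fibonacci_cube n) u p v \<and> length p = card {i. i < n \<and> u ! i \<noteq> v ! i}"
  using assms(1)
proof (induction "card {i. i < n \<and> u ! i \<noteq> v ! i}" arbitrary: u)
  case 0
  interpret wf_digraph "fibonacci_cube n" by (rule wf_digraph_fibonacci_cube)
  have "{i. i < n \<and> u ! i \<noteq> v ! i} = {}" using 0 by simp
  then have "u = v" using 0 assms(2)
    by (intro nth_equalityI) (auto simp: fibonacci_strings_def)
  then have "awalk u [] v" using assms(2) by (simp add: awalk_Nil_iff)
  then show ?case using 0 by force
next
  case (Suc m)
  interpret wf_digraph "fibonacci_cube n" by (rule wf_digraph_fibonacci_cube)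
  let ?D = "\<lambda>u. {i. i < n \<and> u ! i \<noteq> v ! i}"
  have len: "length u = n" "length v = n"
    using Suc.prems assms(2) by (auto simp: fibonacci_strings_def)
  have "\<exists>j\<in>?D u. u[j := v ! j] \<in> fibonacci_strings n"
  proof (cases "\<exists>j\<in>?D u. u ! j")
    case True
    \<comment> \<open>Here the correction turns a one off, which cannot create adjacent
      ones.\<close>
    then obtain j where "j \<in> ?D u" "u ! j" by blast
    then show ?thesis using Suc.prems
      by (intro bexI[of _ j]) (auto simp: fibonacci_strings_def nth_list_update)
  next
    case False
    \<comment> \<open>Now \<open>u\<close> lies letterwise below \<open>v\<close>. Any correction
      keeps it below \<open>v\<close>, and a string below \<open>v\<close> inherits the absence of
      adjacent ones.\<close>
    then have le: "u ! i \<Longrightarrow> v ! i" if "i < n" for i using that by blast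
    have "?D u \<noteq> {}" using Suc.hyps(2) by (metis card.empty nat.distinct(1))
    then obtain j where j: "j \<in> ?D u" by blast
    have "u[j := v ! j] \<in> fibonacci_strings n"
      unfolding fibonacci_strings_def
    proof (intro CollectI conjI allI impI)
      fix i assume i: "Suc i < n"
      have "(u[j := v ! j]) ! k \<Longrightarrow> v ! k" if "k < n" for k
        using le[OF that] j that len by (cases "k = j") auto
      moreover have "\<not> (v ! i \<and> v ! Suc i)" using assms(2) i by (simp add: fibonacci_strings_def)
      ultimately show "\<not> ((u[j := v ! j]) ! i \<and> (u[j := v ! j]) ! Suc i)"
        using i by (meson Suc_lessD)
    qed (use len in simp)
    with j show ?thesis by blast
  qed
  then obtain j where j: "j \<in> ?D u" and fib: "u[j := v ! j] \<in> fibonacci_strings n" by blast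
  let ?u = "u[j := v ! j]"
  have D: "?D ?u = ?D u - {j}" using j len by (auto simp: nth_list_update)
  with Suc.hyps(2) j have m: "m = card (?D ?u)" by simp
  from Suc.hyps(1)[OF m fib] obtain p where p: "awalk ?u p v" "length p = m" using m by auto
  have "{i. i < n \<and> u ! i \<noteq> ?u ! i} = {j}" using j len by (auto simp: nth_list_update)
  then have "(u, ?u) \<in> arcs (fibonacci_cube n)"
    using Suc.prems fib by (auto simp: arcs_fibonacci_cube)
  then have "awalk u ((u, ?u) # p) v" using p by (simp add: awalk_Cons_iff)
  then show ?case using p Suc.hyps(2) by (metis length_Cons)
qed

text \<open>The Hamming distance is at least the graph distance \<open>n\<close>, so all letters
  differ. Two equal adjacent letters would then be two adjacent ones in \<open>u\<close> or in
  \<open>v\<close>.\<close>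

lemma fibonacci_cube_antipodal:
  assumes "u \<in> fibonacci_strings n" "v \<in> fibonacci_strings n"
    and "graph_dist (fibonacci_cube n) u v = ereal (real n)"
  shows "v = map Not u" and "\<And>i. Suc i < n \<Longrightarrow> u ! Suc i \<longleftrightarrow> \<not> u ! i"
proof -
  have len: "length u = n" "length v = n"
    using assms by (auto simp: fibonacci_strings_def)
  obtain p where "pre_digraph.awalk (fibonacci_cube n) u p v"
    "length p = card {i. i < n \<and> u ! i \<noteq> v ! i}"
    using fibonacci_cube_Hamming_walk[OF assms(1,2)] by blast
  then have "n \<le> card {i. i < n \<and> u ! i \<noteq> v ! i}"
    using graph_dist_le_length[OF wf_digraph_fibonacci_cube] assms(3) by fastforce
  then have "{i. i < n \<and> u ! i \<noteq> v ! i} = {..<n}"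
    by (intro card_seteq) auto
  then have neq: "u ! i \<noteq> v ! i" if "i < n" for i using that by auto
  then show "v = map Not u" using len by (intro nth_equalityI) auto
  show "u ! Suc i \<longleftrightarrow> \<not> u ! i" if "Suc i < n" for i
    using neq[of i] neq[of "Suc i"] assms(1,2) that by (auto simp: fibonacci_strings_def)
qed

section \<open>States, paths and admissible orders of flips\<close>

text \<open>Letters are indexed from 0, but \<open>\<tau>\<close> permutes \<open>{1..n}\<close>: letter \<open>i\<close> is flipped in step \<open>\<tau> (i + 1)\<close>.\<close>

definition flip_state :: "bool list \<Rightarrow> (nat \<Rightarrow> nat) \<Rightarrow> nat \<Rightarrow> bool list" where
  "flip_state u \<tau> k = map (\<lambda>i. u ! i \<noteq> (\<tau> (Suc i) \<le> k)) [0..<length u]"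

definition flip_path :: "bool list \<Rightarrow> (nat \<Rightarrow> nat) \<Rightarrow> (bool list \<times> bool list) list" where
  "flip_path u \<tau> = map (\<lambda>k. (flip_state u \<tau> k, flip_state u \<tau> (Suc k))) [0..<length u]"

text \<open>If the letters of \<open>u\<close> alternate, these are the alternating permutations
  when the first letter is zero, and their mirror images (starting with an ascent) when it is
  one.\<close>

definition flip_orders :: "bool list \<Rightarrow> (nat \<Rightarrow> nat) set" where
  "flip_orders u = {\<tau>. \<tau> permutes {1..length u} \<and>
     (\<forall>i. Suc i < length u \<longrightarrow>
       (if u ! i then \<tau> (Suc i) < \<tau> (Suc (Suc i)) else \<tau> (Suc i) > \<tau> (Suc (Suc i))))}"

lemma length_flip_state [simp]: "length (flip_state u \<tau> k) = length u"
  and nth_flip_state [simp]: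
    "i < length u \<Longrightarrow> flip_state u \<tau> k ! i \<longleftrightarrow> u ! i \<noteq> (\<tau> (Suc i) \<le> k)"
  by (simp_all add: flip_state_def)

lemma flip_path_eq_iff:
  "flip_path u \<tau> = flip_path u \<tau>' \<longleftrightarrow>
     (\<forall>k<length u. flip_state u \<tau> k = flip_state u \<tau>' k \<and>
        flip_state u \<tau> (Suc k) = flip_state u \<tau>' (Suc k))"
  by (auto simp: flip_path_def)

lemma permutes_atLeastAtMost_bounds:
  assumes "\<tau> permutes {1..n}" "i < n"
  shows "1 \<le> \<tau> (Suc i)" "\<tau> (Suc i) \<le> n"
proof -
  have "\<tau> (Suc i) \<in> {1..n}"
    using permutes_in_image[OF assms(1), of "Suc i"] assms(2) by simp
  then show "1 \<le> \<tau> (Suc i)" "\<tau> (Suc i) \<le> n" by auto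
qed

text \<open>The states reveal, for every time \<open>k\<close>, which letters have been flipped by
  then, and this determines all flip times.\<close>

lemma inj_on_flip_path: "inj_on (flip_path u) (flip_orders u)"
proof (rule inj_onI)
  fix \<tau> \<tau>'
  assume "\<tau> \<in> flip_orders u" "\<tau>' \<in> flip_orders u" and eq: "flip_path u \<tau> = flip_path u \<tau>'"
  then have perm: "\<tau> permutes {1..length u}" "\<tau>' permutes {1..length u}"
    by (auto simp: flip_orders_def)
  have le_iff: "\<tau> (Suc i) \<le> k \<longleftrightarrow> \<tau>' (Suc i) \<le> k" if "i < length u" "k \<le> length u" for i k
  proof -
    have "flip_state u \<tau> k = flip_state u \<tau>' k"
    \<comment> \<open>Time \<open>0\<close> is read off the tail of the first arc and every later
      time off the head of an arc, since time \<open>length u\<close> occurs only as a head.\<close>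
    proof (cases k)
      case 0
      then show ?thesis using eq that unfolding flip_path_eq_iff by (metis not_gr_zero not_less0)
    next
      case (Suc k')
      then show ?thesis using eq that unfolding flip_path_eq_iff by auto
    qed
    then have "flip_state u \<tau> k ! i = flip_state u \<tau>' k ! i" by simp
    then show ?thesis using that by auto
  qed
  \<comment> \<open>Both flip times are at most \<open>length u\<close>, so each may serve as
    \<open>k\<close> in \<open>le_iff\<close>; this gives the two inequalities.\<close>
  have "\<tau> (Suc i) = \<tau>' (Suc i)" if "i < length u" for i
    using permutes_atLeastAtMost_bounds[OF perm(1) that] permutes_atLeastAtMost_bounds[OF perm(2) that]
      le_iff[OF that] by (meson order_antisym order_refl)
  then have "\<tau> j = \<tau>' j" if "j \<in> {1..length u}" for j
    using that by (cases j) auto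
  moreover have "\<tau> j = \<tau>' j" if "j \<notin> {1..length u}" for j
    using that perm by (simp add: permutes_not_in)
  ultimately show "\<tau> = \<tau>'" by blast
qed

text \<open>Two adjacent letters, initially a one and a zero, are both one at time \<open>k\<close>
  exactly when the zero has been flipped and the one has not. This never happens iff the one is
  flipped first.\<close>

lemma flip_states_fibonacci_iff:
  assumes "\<tau> permutes {1..length u}"
    and alt: "\<And>i. Suc i < length u \<Longrightarrow> u ! Suc i \<longleftrightarrow> \<not> u ! i"
  shows "(\<forall>k\<le>length u. flip_state u \<tau> k \<in> fibonacci_strings (length u)) \<longleftrightarrow> \<tau> \<in> flip_orders u"
    (is "?L \<longleftrightarrow> ?R")
proof -
  let ?n = "length u"
  have *: "(\<forall>k\<le>?n. \<not> (flip_state u \<tau> k ! i \<and> flip_state u \<tau> k ! Suc i)) \<longleftrightarrow>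
    (if u ! i then \<tau> (Suc i) < \<tau> (Suc (Suc i)) else \<tau> (Suc i) > \<tau> (Suc (Suc i)))"
    if i: "Suc i < ?n" for i
  proof -
    have neq: "\<tau> (Suc i) \<noteq> \<tau> (Suc (Suc i))"
      using permutes_inj[OF assms(1)] by (metis injD n_not_Suc_n)
    have le: "\<tau> (Suc i) \<le> ?n" "\<tau> (Suc (Suc i)) \<le> ?n"
      using permutes_atLeastAtMost_bounds(2)[OF assms(1)] i by auto
    show ?thesis
    proof (cases "u ! i")
      case True
      then have "(\<forall>k\<le>?n. \<not> (flip_state u \<tau> k ! i \<and> flip_state u \<tau> k ! Suc i)) \<longleftrightarrow>
          (\<forall>k\<le>?n. \<tau> (Suc (Suc i)) \<le> k \<longrightarrow> \<tau> (Suc i) \<le> k)"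
        using i alt[OF i] by auto
      \<comment> \<open>For the forward direction \<open>k\<close> is the flip time of the zero;
        injectivity makes the inequality strict.\<close>
      also have "\<dots> \<longleftrightarrow> \<tau> (Suc i) < \<tau> (Suc (Suc i))"
        using le neq by (metis le_trans nat_less_le order_refl)
      finally show ?thesis using True by simp
    next
      case False
      then have "(\<forall>k\<le>?n. \<not> (flip_state u \<tau> k ! i \<and> flip_state u \<tau> k ! Suc i)) \<longleftrightarrow>
          (\<forall>k\<le>?n. \<tau> (Suc i) \<le> k \<longrightarrow> \<tau> (Suc (Suc i)) \<le> k)"
        using i alt[OF i] by auto
      also have "\<dots> \<longleftrightarrow> \<tau> (Suc i) > \<tau> (Suc (Suc i))"
        using le neq by (metis le_trans nat_less_le order_refl)
      finally show ?thesis using False by simp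
    qed
  qed
  have "?L \<longleftrightarrow> (\<forall>i. Suc i < ?n \<longrightarrow>
      (\<forall>k\<le>?n. \<not> (flip_state u \<tau> k ! i \<and> flip_state u \<tau> k ! Suc i)))"
    unfolding fibonacci_strings_def by auto
  also have "\<dots> \<longleftrightarrow> (\<forall>i. Suc i < ?n \<longrightarrow>
      (if u ! i then \<tau> (Suc i) < \<tau> (Suc (Suc i)) else \<tau> (Suc i) > \<tau> (Suc (Suc i))))"
    by (intro iff_allI imp_cong refl *)
  also have "\<dots> \<longleftrightarrow> ?R"
    using assms(1) by (simp add: flip_orders_def)
  finally show ?thesis .
qed

text \<open>The two states differ exactly at the positions with flip time \<open>Suc k\<close>.
  Surjectivity of \<open>\<tau>\<close> provides one and injectivity excludes a second.\<close>

lemma flip_state_step: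
  assumes "\<tau> permutes {1..length u}" "k < length u"
  shows "\<exists>j. {i. i < length u \<and> flip_state u \<tau> k ! i \<noteq> flip_state u \<tau> (Suc k) ! i} = {j}"
proof -
  have "Suc k \<in> \<tau> ` {1..length u}"
    using permutes_image[OF assms(1)] assms(2) by simp
  then obtain j where j: "j < length u" "\<tau> (Suc j) = Suc k"
    by (auto simp: image_iff) (metis Suc_le_D Suc_le_eq)
  have "i = j" if "\<tau> (Suc i) = Suc k" for i
    using j that permutes_inj[OF assms(1)] by (metis Suc_inject injD)
  then have "{i. i < length u \<and> \<tau> (Suc i) = Suc k} = {j}"
    using j by blast
  moreover have "{i. i < length u \<and> flip_state u \<tau> k ! i \<noteq> flip_state u \<tau> (Suc k) ! i} =
      {i. i < length u \<and> \<tau> (Suc i) = Suc k}"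
    by auto
  ultimately show ?thesis by blast
qed

section \<open>Correspondence between flip orders and shortest paths\<close>

lemma flip_path_apath:
  assumes alt: "\<And>i. Suc i < length u \<Longrightarrow> u ! Suc i \<longleftrightarrow> \<not> u ! i"
    and "\<tau> \<in> flip_orders u"
  shows "pre_digraph.apath (fibonacci_cube (length u)) u (flip_path u \<tau>) (map Not u)"
proof -
  let ?n = "length u"
  interpret wf_digraph "fibonacci_cube ?n" by (rule wf_digraph_fibonacci_cube)
  have perm: "\<tau> permutes {1..?n}" using assms(2) by (simp add: flip_orders_def)
  have fib: "flip_state u \<tau> k \<in> fibonacci_strings ?n" if "k \<le> ?n" for k
    using flip_states_fibonacci_iff[OF perm alt] assms(2) that by blast
  note bounds = permutes_atLeastAtMost_bounds[OF perm]
  \<comment> \<open>Flip times lie between 1 and \<open>?n\<close>: nothing has been flipped at time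
    0, and everything has at time \<open>?n\<close>.\<close>
  have ends: "flip_state u \<tau> 0 = u" "flip_state u \<tau> ?n = map Not u"
    using bounds by (auto intro!: nth_equalityI) fastforce+
  have arc: "(flip_state u \<tau> k, flip_state u \<tau> (Suc k)) \<in> arcs (fibonacci_cube ?n)" if "k < ?n" for k
    using fib[of k] fib[of "Suc k"] flip_state_step[OF perm that] that
    unfolding arcs_fibonacci_cube by (meson Suc_leI less_imp_le)
  have walk: "awalk u (flip_path u \<tau>) (map Not u)"
    and verts: "awalk_verts u (flip_path u \<tau>) = map (flip_state u \<tau>) [0..<Suc ?n]"
    using awalk_map_upt[of "flip_state u \<tau>" ?n
        "\<lambda>k. (flip_state u \<tau> k, flip_state u \<tau> (Suc k))"] fib[of 0] arc
    unfolding flip_path_def by (simp_all add: ends del: upt_Suc)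
  have "flip_state u \<tau> k \<noteq> flip_state u \<tau> l" if "k < l" "l \<le> ?n" for k l
  proof
    assume eq: "flip_state u \<tau> k = flip_state u \<tau> l"
    \<comment> \<open>The letter flipped at time \<open>l\<close> still has its old value at the
      earlier time \<open>k\<close>, so it separates the two states.\<close>
    have "l \<in> \<tau> ` {1..?n}"
      using permutes_image[OF perm] that by simp
    then obtain j where j: "j < ?n" "\<tau> (Suc j) = l"
      by (auto simp: image_iff) (metis Suc_le_D Suc_le_eq)
    from eq have "flip_state u \<tau> k ! j = flip_state u \<tau> l ! j" by simp
    then show False using j that by simp
  qed
  then have "inj_on (flip_state u \<tau>) {0..<Suc ?n}"
    by (intro linorder_inj_onI) auto
  then show ?thesis
    using walk verts by (simp add: apath_def distinct_map del: upt_Suc)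
qed

text \<open>A walk of length \<open>n\<close> between complementary strings has to change every letter, so no letter is
  changed twice.\<close>

lemma complementary_walk_flip_states:
  assumes w0: "w 0 = u" and wn: "w n = map Not u" and len: "\<And>k. k \<le> n \<Longrightarrow> length (w k) = n"
    and step: "\<And>k. k < n \<Longrightarrow> \<exists>j. {i. i < n \<and> w k ! i \<noteq> w (Suc k) ! i} = {j}"
  obtains \<tau> where "\<tau> permutes {1..n}" "\<And>k. k \<le> n \<Longrightarrow> w k = flip_state u \<tau> k"
proof -
  have lu: "length u = n" using len[of 0] w0 by simp
  obtain c where c: "\<And>k. k < n \<Longrightarrow> {i. i < n \<and> w k ! i \<noteq> w (Suc k) ! i} = {c k}"
    using step by metis
  have c_lt: "c k < n" if "k < n" for k using c[OF that] by auto
  have c_iff: "w (Suc k) ! i = w k ! i \<longleftrightarrow> i \<noteq> c k" if "k < n" "i < n" for k i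
    using c[OF that(1)] that(2) by blast
  \<comment> \<open>A letter missed by all steps would keep its value from \<open>u\<close> up to
    time \<open>n\<close>, where \<open>w n\<close> has the opposite one.\<close>
  have "i \<in> c ` {..<n}" if i: "i < n" for i
  proof (rule ccontr)
    assume no: "i \<notin> c ` {..<n}"
    have "w k ! i = u ! i" if "k \<le> n" for k
      using that
    proof (induction k)
      case (Suc k)
      then show ?case using c_iff[of k i] i no by auto
    qed (simp add: w0)
    from this[of n] show False using wn i lu by simp
  qed
  then have img: "c ` {..<n} = {..<n}" using c_lt by auto
  then have inj: "inj_on c {..<n}" by (intro eq_card_imp_inj_on) auto
  define d where "d = inv_into {..<n} c"
  have d: "d i < n" "c (d i) = i" if "i < n" for i
    using that img inv_into_into[of i c "{..<n}"] f_inv_into_f[of i c "{..<n}"] by (auto simp: d_def)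
  have dc: "d i = k \<longleftrightarrow> i = c k" if "i < n" "k < n" for i k
    using that d inj by (auto simp: inj_on_def)
  \<comment> \<open>\<open>c\<close> sends steps to positions and \<open>d\<close> inverts it, both
    counting from 0. \<open>\<tau>\<close> counts both from 1, because step \<open>k\<close> takes
    effect at time \<open>Suc k\<close>, and it is the identity elsewhere, as
    \<open>permutes\<close> demands.\<close>
  define \<tau> where "\<tau> j = (if j \<in> {1..n} then Suc (d (j - 1)) else j)" for j
  have "\<tau> permutes {1..n}"
  proof (rule bij_imp_permutes)
    have "inj_on \<tau> {1..n}"
    proof (rule inj_onI)
      fix i j assume ij: "i \<in> {1..n}" "j \<in> {1..n}" "\<tau> i = \<tau> j"
      then have "i - 1 < n" "j - 1 < n" "d (i - 1) = d (j - 1)" by (auto simp: \<tau>_def)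
      then have "i - 1 = j - 1" using d(2) by metis
      with ij(1,2) show "i = j" unfolding atLeastAtMost_iff by linarith
    qed
    moreover have "\<tau> ` {1..n} \<subseteq> {1..n}" using d(1) by (auto simp: \<tau>_def Suc_le_eq)
    ultimately show "bij_betw \<tau> {1..n} {1..n}"
      by (simp add: bij_betw_def endo_inj_surj)
  qed (auto simp: \<tau>_def)
  moreover have "w k = flip_state u \<tau> k" if "k \<le> n" for k
  proof (rule nth_equalityI)
    fix i assume "i < length (w k)"
    then have i: "i < n" using len that by simp
    have "w k ! i \<longleftrightarrow> u ! i \<noteq> (Suc (d i) \<le> k)"
      using that
    proof (induction k)
      case (Suc k)
      then show ?case using c_iff[of k i] dc[of i k] i by auto
    qed (simp add: w0)
    then show "w k ! i = flip_state u \<tau> k ! i" using i lu by (simp add: \<tau>_def)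
  qed (use len that lu in simp)
  ultimately show thesis by (rule that)
qed

text \<open>By \<open>dist\<close>, shortest paths have exactly one arc per letter. Hence
  \<open>complementary_walk_flip_states\<close> recovers the order of flips from such a
  path.\<close>

lemma shortest_paths_eq_flip_paths:
  assumes alt: "\<And>i. Suc i < length u \<Longrightarrow> u ! Suc i \<longleftrightarrow> \<not> u ! i"
    and dist: "graph_dist (fibonacci_cube (length u)) u (map Not u) = ereal (real (length u))"
  shows "shortest_paths (fibonacci_cube (length u)) u (map Not u) = flip_path u ` flip_orders u"
proof (intro equalityI subsetI)
  let ?n = "length u"
  interpret wf_digraph "fibonacci_cube ?n" by (rule wf_digraph_fibonacci_cube)
  {
    fix p assume "p \<in> flip_path u ` flip_orders u"
    then show "p \<in> shortest_paths (fibonacci_cube ?n) u (map Not u)"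
      using flip_path_apath[OF alt] dist by (auto simp: shortest_paths_def flip_path_def)
  next
    fix p assume "p \<in> shortest_paths (fibonacci_cube ?n) u (map Not u)"
    then have p: "awalk u p (map Not u)" "length p = ?n"
      by (auto simp: shortest_paths_def dist apath_def)
    obtain w where w: "w 0 = u" "w ?n = map Not u"
      and "\<And>k. k < ?n \<Longrightarrow> p ! k \<in> arcs (fibonacci_cube ?n) \<and> fst (p ! k) = w k \<and> snd (p ! k) = w (Suc k)"
      using awalk_imp_steps[OF p(1)] p(2) by (metis tail_fibonacci_cube head_fibonacci_cube)
    then have pk: "p ! k = (w k, w (Suc k))"
      and arc: "(w k, w (Suc k)) \<in> arcs (fibonacci_cube ?n)" if "k < ?n" for k
      using that by (metis prod.collapse)+
    have "u \<in> fibonacci_strings ?n" using p(1) by (auto simp: awalk_def)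
    \<comment> \<open>The state at time 0 is \<open>u\<close>; each later one is the head of the arc
      with index \<open>k - 1\<close>.\<close>
    then have fib: "w k \<in> fibonacci_strings ?n" if "k \<le> ?n" for k
      using that arc[of "k - 1"] w(1) by (cases k) (auto simp: arcs_fibonacci_cube)
    have "length (w k) = ?n" if "k \<le> ?n" for k
      using fib[OF that] by (simp add: fibonacci_strings_def)
    moreover have "\<exists>j. {i. i < ?n \<and> w k ! i \<noteq> w (Suc k) ! i} = {j}" if "k < ?n" for k
      using arc[OF that] by (simp add: arcs_fibonacci_cube)
    ultimately obtain \<tau> where perm: "\<tau> permutes {1..?n}"
      and states: "\<And>k. k \<le> ?n \<Longrightarrow> w k = flip_state u \<tau> k"
      using complementary_walk_flip_states[OF w] by blast
    have "\<tau> \<in> flip_orders u"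
      using flip_states_fibonacci_iff[OF perm alt] fib states by metis
    moreover have "p = flip_path u \<tau>"
      using p(2) pk states by (intro nth_equalityI) (auto simp: flip_path_def)
    ultimately show "p \<in> flip_path u ` flip_orders u" by blast
  }
qed

section \<open>Counting flip orders by Euler numbers\<close>

text \<open>The order-reversing involution of \<open>{1..n}\<close>, extended by the identity so
  that composition with it preserves \<open>permutes\<close>.\<close>

definition value_reversal :: "nat \<Rightarrow> nat \<Rightarrow> nat" where
  "value_reversal n j = (if j \<in> {1..n} then n + 1 - j else j)"

lemma value_reversal_involution: "value_reversal n (value_reversal n j) = j"
  by (auto simp: value_reversal_def)

lemma value_reversal_permutes: "value_reversal n permutes {1..n}"
proof (rule bij_imp_permutes)
  show "bij_betw (value_reversal n) {1..n} {1..n}"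
    by (rule bij_betw_byWitness[where f' = "value_reversal n"])
      (auto simp: value_reversal_involution, auto simp: value_reversal_def)
qed (auto simp: value_reversal_def)

lemma value_reversal_less_iff:
  assumes "i \<in> {1..n}" "j \<in> {1..n}"
  shows "value_reversal n i < value_reversal n j \<longleftrightarrow> j < i"
  using assms by (auto simp: value_reversal_def)

text \<open>Complementing \<open>u\<close> reverses each inequality in \<open>flip_orders\<close>,
  and so does reversing the values.\<close>

lemma flip_orders_map_Not:
  "bij_betw (\<lambda>\<tau>. value_reversal (length u) \<circ> \<tau>) (flip_orders u) (flip_orders (map Not u))"
proof -
  let ?n = "length u"
  let ?r = "\<lambda>\<tau>. value_reversal ?n \<circ> \<tau>"
  have *: "?r \<tau> \<in> flip_orders (map Not b)" if "\<tau> \<in> flip_orders b" "length b = ?n" for \<tau> b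
  proof -
    have perm: "\<tau> permutes {1..?n}" using that by (simp add: flip_orders_def)
    then have mem: "\<tau> (Suc i) \<in> {1..?n}" if "i < ?n" for i
      using permutes_atLeastAtMost_bounds that by (metis atLeastAtMost_iff)
    have "?r \<tau> permutes {1..?n}"
      by (rule permutes_compose[OF perm value_reversal_permutes])
    then show ?thesis
      using that mem by (simp add: flip_orders_def value_reversal_less_iff)
  qed
  \<comment> \<open>Complementation is an involution too, so the same map leads back from
    \<open>map Not u\<close> to \<open>u\<close>.\<close>
  have "map Not (map Not u) = u" by (simp add: comp_def)
  then have "?r ` flip_orders (map Not u) \<subseteq> flip_orders u"
    using *[of _ "map Not u"] by auto
  moreover have "?r (?r \<tau>) = \<tau>" for \<tau> by (simp add: fun_eq_iff value_reversal_involution)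
  ultimately show ?thesis
    using * by (intro bij_betw_byWitness[where f' = ?r]) auto
qed

text \<open>With a zero in front, the inequalities of \<open>flip_orders\<close> are those of
  \<open>alternating\<close>. With a one in front, complementing \<open>u\<close> reduces to that
  case.\<close>

lemma card_flip_orders:
  assumes alt: "\<And>i. Suc i < length u \<Longrightarrow> u ! Suc i \<longleftrightarrow> \<not> u ! i" and "u \<noteq> []"
  shows "card (flip_orders u) = euler_number (length u)"
proof -
  have zero_first: "card (flip_orders b) = euler_number (length b)"
    if alt: "\<And>i. Suc i < length b \<Longrightarrow> b ! Suc i \<longleftrightarrow> \<not> b ! i"
      and "\<not> b ! 0" for b :: "bool list"
  proof -
    have b: "b ! i \<longleftrightarrow> odd i" if "i < length b" for i
      using that
    proof (induction i)
      case (Suc i)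
      then show ?case using alt[of i] by simp
    qed (use \<open>\<not> b ! 0\<close> in simp)
    have "alternating (length b) \<tau> \<longleftrightarrow> (\<forall>i. Suc i < length b \<longrightarrow>
       (if b ! i then \<tau> (Suc i) < \<tau> (Suc (Suc i)) else \<tau> (Suc i) > \<tau> (Suc (Suc i))))"
      (is "_ \<longleftrightarrow> (\<forall>i. Suc i < _ \<longrightarrow> ?P i)") for \<tau>
    proof -
      \<comment> \<open>Positions of \<open>\<tau>\<close> count from 1 and letters from 0, so an
        odd position \<open>Suc i\<close> belongs to an even index \<open>i\<close>, where
        \<open>b\<close> has a zero.\<close>
      have "alternating (length b) \<tau> \<longleftrightarrow> (\<forall>i. Suc i < length b \<longrightarrow>
        (if odd (Suc i) then \<tau> (Suc i) > \<tau> (Suc i + 1) else \<tau> (Suc i) < \<tau> (Suc i + 1)))"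
      proof -
        have img: "{1..<length b} = Suc ` {i. Suc i < length b}"
          by (auto simp: image_iff Suc_le_eq gr0_conv_Suc)
        show ?thesis unfolding alternating_def img by simp
      qed
      also have "\<dots> \<longleftrightarrow> (\<forall>i. Suc i < length b \<longrightarrow> ?P i)"
        using b by (auto simp: Suc_lessD)
      finally show ?thesis .
    qed
    then show ?thesis unfolding euler_number_def flip_orders_def by simp
  qed
  show ?thesis
  proof (cases "u ! 0")
    case True
    have "card (flip_orders u) = card (flip_orders (map Not u))"
      using flip_orders_map_Not by (rule bij_betw_same_card)
    also have "\<dots> = euler_number (length (map Not u))"
      using alt \<open>u \<noteq> []\<close> True by (intro zero_first) auto
    finally show ?thesis by simp
  qed (use alt zero_first in blast)
qed

theorem theorem1:
  fixes n :: nat and u v :: "bool list"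
  assumes "n \<ge> 1"
    and "u \<in> verts (fibonacci_cube n)"
    and "v \<in> verts (fibonacci_cube n)"
    and "graph_dist (fibonacci_cube n) u v = ereal (real n)"
  shows "card (shortest_paths (fibonacci_cube n) u v) = euler_number n"
proof -
  have uv: "u \<in> fibonacci_strings n" "v \<in> fibonacci_strings n" using assms by simp_all
  then have n: "n = length u" by (simp add: fibonacci_strings_def)
  then have "u \<noteq> []" using assms(1) by auto
  note v = fibonacci_cube_antipodal(1)[OF uv assms(4)]
  have alt: "\<And>i. Suc i < length u \<Longrightarrow> u ! Suc i \<longleftrightarrow> \<not> u ! i"
    using fibonacci_cube_antipodal(2)[OF uv assms(4)] n by simp
  have "card (shortest_paths (fibonacci_cube n) u v) = card (flip_path u ` flip_orders u)"
    using shortest_paths_eq_flip_paths[OF alt] assms(4) v n by simp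
  also have "\<dots> = card (flip_orders u)"
    by (rule card_image[OF inj_on_flip_path])
  also have "\<dots> = euler_number n"
    using card_flip_orders[OF alt \<open>u \<noteq> []\<close>] n by simp
  finally show ?thesis .
qed

end
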